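(* Let $H$ be a tournament. If $H$ is $\vec{\chi}$-binding, then $H$ admits a total ordering $\prec$ of its vertices whose backedge graph $H^{\prec}$ is a forest.
   Context: All graphs and digraphs are finite, with no loops, no parallel edges or arcs, and no anti-parallel arcs. A tournament is an orientation of a complete graph. The dichromatic number $\vec{\chi}(D)$ of a digraph $D$ is the least $k$ such that $V(D)$ can be partitioned into $k$ sets each inducing an acyclic subdigraph. For a total ordering $\prec$ of $V(D)$, the backedge graph $D^{\prec}$ is the undirected graph with vertex set $V(D)$ in which, for $u\prec v$, $uv$ is an edge if and only if $vu\in A(D)$. The clique number of $D$ is $\vec{\omega}(D)=\min\{\omega(D^{\prec}) : \prec \text{ a total ordering of } V(D)\}$. A class $\mathcal{C}$ of digraphs is $\vec{\chi}$-bounded if there is an increasing function $f$ with $\vec{\chi}(D)\le f(\vec{\omega}(D))$ for every $D\in\mathcal{C}$. A tournament $H$ is $\vec{\chi}$-binding if the class of $H$-free tournaments (tournaments containing no subtournament isomorphic to $H$) is $\vec{\chi}$-bounded. *)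

theory Defs
  imports
    Graph_Theory.Digraph_Isomorphism
    "HOL-Library.Disjoint_Sets"
begin

text \<open>
  A pair digraph (\<^locale>\<open>pair_digraph\<close>) is finite and loopless, and has no parallel arcs because
  its arcs are pairs of vertices; digraphs here also have no anti-parallel arcs.
\<close>

locale oriented_graph = pair_digraph +
  assumes no_antiparallel: "(u, v) \<in> parcs G \<Longrightarrow> (v, u) \<notin> parcs G"

locale tournament = oriented_graph +
  assumes semicomplete:
    "\<lbrakk>u \<in> pverts G; v \<in> pverts G; u \<noteq> v\<rbrakk> \<Longrightarrow> (u, v) \<in> parcs G \<or> (v, u) \<in> parcs G"

definition acyclic_digraph :: "('a, 'b) pre_digraph \<Rightarrow> bool" where
  "acyclic_digraph D \<longleftrightarrow> (\<nexists>p. pre_digraph.cycle D p)"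

definition dichromatic_number :: "'a pair_pre_digraph \<Rightarrow> nat" where
  "dichromatic_number D =
    (LEAST k. \<exists>P. partition_on (pverts D) P \<and> card P = k \<and>
      (\<forall>X\<in>P. acyclic_digraph (with_proj D \<restriction> X)))"

text \<open>
  As in \<^theory>\<open>Graph_Theory.Digraph\<close>, an undirected graph is a symmetric digraph (\<^locale>\<open>pair_graph\<close>):
  the edge \<open>uv\<close> is the pair of arcs \<open>(u, v)\<close> and \<open>(v, u)\<close>.
\<close>

definition clique :: "'a pair_pre_digraph \<Rightarrow> 'a set \<Rightarrow> bool" where
  "clique G X \<longleftrightarrow> X \<subseteq> pverts G \<and> (\<forall>u\<in>X. \<forall>v\<in>X. u \<noteq> v \<longrightarrow> (u, v) \<in> parcs G)"

definition clique_number :: "'a pair_pre_digraph \<Rightarrow> nat" where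
  "clique_number G = Max (card ` {X. clique G X})"

text \<open>
  Undirected cycles have length at least 3. The constant \<^const>\<open>forest\<close> of the library cannot be used
  for undirected graphs, since it counts the closed walk \<open>u, v, u\<close> along a single edge as a cycle.
\<close>

definition undirected_forest :: "'a pair_pre_digraph \<Rightarrow> bool" where
  "undirected_forest G \<longleftrightarrow> (\<nexists>p. pre_digraph.cycle (with_proj G) p \<and> 3 \<le> length p)"

text \<open>The order \<open>r\<close> is reflexive, as in \<^const>\<open>linear_order_on\<close>; \<open>u \<prec> v\<close> is its strict part.\<close>

definition backedge_graph :: "'a pair_pre_digraph \<Rightarrow> 'a rel \<Rightarrow> 'a pair_pre_digraph" where
  "backedge_graph D r =
    \<lparr> pverts = pverts D,
      parcs = (let B = {(u, v). (u, v) \<in> r \<and> u \<noteq> v \<and> (v, u) \<in> parcs D} in B \<union> B\<inverse>) \<rparr>"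

lemma pair_graph_backedge_graph:
  assumes "pair_digraph D"
  shows "pair_graph (backedge_graph D r)"
proof -
  interpret pair_digraph D by (fact assms)
  have sub: "parcs (backedge_graph D r) \<subseteq> pverts D \<times> pverts D"
    by (auto simp: backedge_graph_def Let_def dest: in_arcsD1 in_arcsD2)
  show ?thesis
  proof
    show "finite (parcs (backedge_graph D r))"
      using sub pair_finite_verts by (meson finite_SigmaI finite_subset)
  qed (use sub pair_finite_verts in
        \<open>auto simp: backedge_graph_def Let_def Digraph.symmetric_def sym_def\<close>)
qed

definition directed_clique_number :: "'a pair_pre_digraph \<Rightarrow> nat" where
  "directed_clique_number D =
    (LEAST k. \<exists>r. linear_order_on (pverts D) r \<and> clique_number (backedge_graph D r) = k)"

definition dichi_bounded :: "'a pair_pre_digraph set \<Rightarrow> bool" where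
  "dichi_bounded C \<longleftrightarrow>
    (\<exists>f :: nat \<Rightarrow> nat. mono f \<and> (\<forall>D\<in>C. dichromatic_number D \<le> f (directed_clique_number D)))"

text \<open>Every subtournament of a tournament is induced by its set of vertices.\<close>

definition contains_copy :: "'b pair_pre_digraph \<Rightarrow> 'a pair_pre_digraph \<Rightarrow> bool" where
  "contains_copy T H \<longleftrightarrow> (\<exists>X \<subseteq> pverts T. digraph_iso (with_proj H) (with_proj T \<restriction> X))"

text \<open>
  Finite tournaments are taken up to isomorphism, so it suffices to consider those whose vertices
  are natural numbers; the vertex type of \<open>H\<close> is arbitrary.
\<close>

definition dichi_binding :: "'a pair_pre_digraph \<Rightarrow> bool" where
  "dichi_binding H \<longleftrightarrow>
    dichi_bounded {T :: nat pair_pre_digraph. tournament T \<and> \<not> contains_copy T H}"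

end

theory Submission
  imports Defs Complex_Main "HOL-Library.FuncSet"
begin

text \<open>
  The plan is to turn a graph of large girth and large chromatic number into a tournament. Given a
  graph \<open>E\<close> on a linearly ordered vertex set \<open>V\<close>, let \<open>T\<close> be the tournament whose backedge graph with
  respect to the given order is \<open>E\<close>: arcs point upwards except along edges of \<open>E\<close>.
  If \<open>E\<close> has girth larger than 3 and larger than the number of vertices of \<open>H\<close>, then three things hold.

  \<^item> The clique number of \<open>T\<close> is at most 2, because \<open>E\<close> has no triangle
    (\<open>directed_clique_number_tournament_of\<close>).

  \<^item> Every acyclic set of vertices of \<open>T\<close> is a union of two independent sets of \<open>E\<close>. Such a set \<open>X\<close>
    carries a second linear order, its topological order in \<open>T\<close>, and the edges of \<open>E\<close> inside \<open>X\<close> are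
    the pairs on which the two orders disagree; so \<open>E\<close> restricted to \<open>X\<close> is a triangle-free
    permutation graph, hence bipartite. If all independent sets of \<open>E\<close> are small compared with
    \<open>V\<close>, the dichromatic number of \<open>T\<close> is therefore large (\<open>card_le_dichromatic_number\<close>).

  \<^item> If \<open>T\<close> contains a copy of \<open>H\<close>, ordering \<open>H\<close> as its copy in \<open>V\<close> makes the backedge graph of
    \<open>H\<close> isomorphic to a subgraph of \<open>E\<close> that has too few vertices to contain a cycle, that is, to a
    forest (\<open>forest_order_of_contains_copy\<close>).

  If \<open>H\<close> is binding with bounding function \<open>f\<close>, then a dichromatic number above \<open>f 2\<close> forces \<open>T\<close> to
  contain \<open>H\<close>, and the third point gives the ordering.

  What remains is Erdos's theorem that the required graphs exist, in the form
  \<open>large_girth_small_independence\<close>. It follows from the first-moment method: in a random graph of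
  large constant average degree, the expected number of short cycles is bounded independently of the
  number \<open>n\<close> of vertices, while the expected number of independent sets of a certain size linear in
  \<open>n\<close> is at most one half; deleting one vertex of each short cycle leaves more than half of the vertices.
\<close>

section \<open>Cycles and independent sets\<close>

text \<open>
  A cycle is given by the cyclic list of its vertices. Graphs are represented by sets of doubletons,
  so that an edge of the random graph below is a single event and not two.
\<close>

definition cycle_edges :: "'a list \<Rightarrow> 'a set set" where
  "cycle_edges vs = (\<lambda>i. {vs ! i, vs ! (Suc i mod length vs)}) ` {..<length vs}"

definition undirected_cycle :: "'a list \<Rightarrow> bool" where
  "undirected_cycle vs \<longleftrightarrow> distinct vs \<and> 3 \<le> length vs"

definition independent_set :: "'a set set \<Rightarrow> 'a set \<Rightarrow> bool" where
  "independent_set E I \<longleftrightarrow> (\<forall>u\<in>I. \<forall>v\<in>I. u \<noteq> v \<longrightarrow> {u, v} \<notin> E)"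

text \<open>
  The bound 3 on the length matters: the list \<open>[a, b]\<close> runs through its only edge twice. In a longer
  list, edges \<open>i\<close> and \<open>j\<close> could only coincide with their ends exchanged, which would make \<open>i\<close> and
  \<open>i + 2\<close> congruent modulo the length.
\<close>

lemma card_cycle_edges:
  assumes "undirected_cycle vs"
  shows "card (cycle_edges vs) = length vs"
proof -
  let ?l = "length vs"
  have d: "distinct vs" and l: "3 \<le> ?l"
    using assms by (auto simp: undirected_cycle_def)
  have "inj_on (\<lambda>i. {vs ! i, vs ! (Suc i mod ?l)}) {..<?l}"
  proof (rule inj_onI)
    fix i j
    assume i: "i \<in> {..<?l}" and j: "j \<in> {..<?l}"
      and eq: "{vs ! i, vs ! (Suc i mod ?l)} = {vs ! j, vs ! (Suc j mod ?l)}"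
    have m: "Suc i mod ?l < ?l" "Suc j mod ?l < ?l"
      using l by (auto intro!: mod_less_divisor)
    have "i = j \<or> (i = Suc j mod ?l \<and> Suc i mod ?l = j)"
      using eq i j m d by (auto simp: doubleton_eq_iff nth_eq_iff_index_eq)
    then show "i = j"
      using i j l by (auto simp: mod_Suc split: if_splits)
  qed
  then show ?thesis
    by (simp add: cycle_edges_def card_image)
qed

lemma cycle_edges_two_subsets:
  assumes "undirected_cycle vs" "set vs \<subseteq> V"
  shows "cycle_edges vs \<subseteq> {e. e \<subseteq> V \<and> card e = 2}"
proof
  fix e assume "e \<in> cycle_edges vs"
  then obtain i where i: "i < length vs" and e: "e = {vs ! i, vs ! (Suc i mod length vs)}"
    by (auto simp: cycle_edges_def)
  have m: "Suc i mod length vs < length vs" "Suc i mod length vs \<noteq> i"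
    using assms(1) i by (auto simp: undirected_cycle_def mod_Suc)
  then have "vs ! i \<noteq> vs ! (Suc i mod length vs)"
    using assms(1) i nth_eq_iff_index_eq[of vs] by (fastforce simp: undirected_cycle_def)
  moreover have "vs ! i \<in> V" "vs ! (Suc i mod length vs) \<in> V"
    using assms(2) i m nth_mem by blast+
  ultimately show "e \<in> {e. e \<subseteq> V \<and> card e = 2}"
    using e by simp
qed

section \<open>Sparse graphs without large independent sets\<close>

text \<open>
  Read with the uniform distribution on \<open>P \<rightarrow>\<^sub>E Q\<close>, this is the independence of the values at
  different points: all points of \<open>A\<close> take values in \<open>B\<close> with probability
  \<open>(card B / card Q) ^ card A\<close>.
\<close>

lemma card_PiE_constrained:
  assumes "finite P" "A \<subseteq> P" "finite Q" "Q \<noteq> {}" "B \<subseteq> Q"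
  shows "real (card {f \<in> P \<rightarrow>\<^sub>E Q. \<forall>e\<in>A. f e \<in> B}) =
    real (card Q) ^ card P * (real (card B) / real (card Q)) ^ card A"
proof -
  have "{f \<in> P \<rightarrow>\<^sub>E Q. \<forall>e\<in>A. f e \<in> B} = (\<Pi>\<^sub>E e\<in>P. if e \<in> A then B else Q)"
    using assms by (fastforce simp: PiE_iff split: if_splits)
  then have "card {f \<in> P \<rightarrow>\<^sub>E Q. \<forall>e\<in>A. f e \<in> B} = (\<Prod>e\<in>P. if e \<in> A then card B else card Q)"
    using assms(1) by (simp add: card_PiE if_distrib cong: if_cong)
  also have "\<dots> = card B ^ card A * card Q ^ card (P - A)"
    using assms by (simp add: prod.If_cases Int_absorb1 Diff_eq)
  finally have "real (card {f \<in> P \<rightarrow>\<^sub>E Q. \<forall>e\<in>A. f e \<in> B}) =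
      real (card B) ^ card A * real (card Q) ^ card (P - A)"
    by simp
  moreover have "card P = card (P - A) + card A"
    using assms by (metis card_Diff_subset card_mono finite_subset le_add_diff_inverse2)
  moreover have "real (card Q) > 0"
    using assms by (simp add: card_gt_0_iff)
  ultimately show ?thesis
    by (simp add: power_add power_divide)
qed

text \<open>
  With \<open>c\<close> the edge probability, this bounds the expected number of short cycles. There are at most
  \<open>n ^ l\<close> vertex lists of length \<open>l\<close>; that each cycle is represented by several lists does no harm.
\<close>

lemma sum_over_short_cycles:
  fixes c :: real
  assumes "c \<ge> 0"
  shows "(\<Sum>vs | set vs \<subseteq> {..<n} \<and> undirected_cycle vs \<and> length vs \<le> g. c ^ length vs)
    \<le> (\<Sum>l\<le>g. (real n * c) ^ l)"
proof -
  let ?L = "\<lambda>l. {vs. set vs \<subseteq> {..<n} \<and> length vs = l}"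
  have "(\<Sum>vs | set vs \<subseteq> {..<n} \<and> undirected_cycle vs \<and> length vs \<le> g. c ^ length vs)
      \<le> (\<Sum>vs \<in> (\<Union>l\<in>{..g}. ?L l). c ^ length vs)"
    using assms by (intro sum_mono2) (auto simp: finite_lists_length_eq)
  also have "\<dots> = (\<Sum>l\<le>g. \<Sum>vs\<in>?L l. c ^ length vs)"
    by (intro sum.UNION_disjoint) (auto simp: finite_lists_length_eq)
  also have "\<dots> = (\<Sum>l\<le>g. (real n * c) ^ l)"
    by (simp add: card_lists_length_eq power_mult_distrib)
  finally show ?thesis .
qed

text \<open>
  The left-hand side of the assumption \<open>small\<close> bounds the expected value of
  \<open>2 / n * (number of short cycles) + (number of independent s-sets)\<close> in the random graph on \<open>n\<close>
  vertices with edge probability \<open>1 / q\<close>, so some graph gives this quantity a value below 1. The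
  probability space consists of the functions \<open>f\<close> from the two-element vertex sets to \<open>{..<q}\<close>, the
  edges being the sets to which \<open>f\<close> assigns 0; all expectations are thereby finite sums over \<open>f\<close>,
  evaluated by double counting.
\<close>

lemma first_moment:
  fixes n q s g :: nat
  assumes "q > 0" "n > 0"
    and small: "2 / real n * (\<Sum>l\<le>g. (real n / real q) ^ l)
      + 2 ^ n * (1 - 1 / real q) ^ (s choose 2) < 1"
  shows "\<exists>E. 2 * card {vs. set vs \<subseteq> {..<n} \<and> undirected_cycle vs \<and> length vs \<le> g \<and> cycle_edges vs \<subseteq> E} < n
    \<and> (\<forall>S \<subseteq> {..<n}. card S = s \<longrightarrow> \<not> independent_set E S)"
proof (rule ccontr)
  define P where "P = {e. e \<subseteq> {..<n} \<and> card e = 2}"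
  define \<Omega> where "\<Omega> = P \<rightarrow>\<^sub>E {..<q}"
  define M where "M = real q ^ card P"
  define E where "E f = {e \<in> P. f e = 0}" for f :: "nat set \<Rightarrow> nat"
  define C where "C = {vs. set vs \<subseteq> {..<n} \<and> undirected_cycle vs \<and> length vs \<le> g}"
  define D where "D = {S. S \<subseteq> {..<n} \<and> card S = s}"
  define cyc where "cyc f = card {vs \<in> C. cycle_edges vs \<subseteq> E f}" for f
  define ind where "ind f = card {S \<in> D. independent_set (E f) S}" for f
  have finP: "finite P" unfolding P_def by simp
  then have finO: "finite \<Omega>" unfolding \<Omega>_def by (intro finite_PiE) auto
  have "C \<subseteq> {vs. set vs \<subseteq> {..<n} \<and> length vs \<le> g}" unfolding C_def by auto
  then have finC: "finite C" using finite_lists_length_le finite_subset by blast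
  have finD: "finite D" unfolding D_def by simp
  have card_O: "real (card \<Omega>) = M"
    using finP by (simp add: \<Omega>_def M_def card_PiE)
  have M: "M > 0" using assms(1) by (simp add: M_def)
  assume "\<not> ?thesis"
  then have bad: "\<not> (2 * card {vs. set vs \<subseteq> {..<n} \<and> undirected_cycle vs \<and> length vs \<le> g
      \<and> cycle_edges vs \<subseteq> E'} < n \<and> (\<forall>S \<subseteq> {..<n}. card S = s \<longrightarrow> \<not> independent_set E' S))" for E'
    by blast
  have one: "1 \<le> 2 / real n * real (cyc f) + real (ind f)" for f
  proof (cases "2 * cyc f < n")
    case True
    then obtain S where "S \<in> D" "independent_set (E f) S"
      using bad[of "E f"] by (auto simp: cyc_def C_def D_def conj_assoc)
    then have "ind f \<noteq> 0"
      using finD by (auto simp: ind_def)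
    then have "1 \<le> real (ind f)" by simp
    moreover have "0 \<le> 2 / real n * real (cyc f)" by simp
    ultimately show ?thesis by linarith
  next
    case False
    then have "real n \<le> 2 * real (cyc f)" by linarith
    then have "1 \<le> 2 / real n * real (cyc f)"
      using assms(2) by (simp add: field_simps)
    then show ?thesis by simp
  qed
  have cyc_count: "real (card {f \<in> \<Omega>. cycle_edges vs \<subseteq> E f}) = M * (1 / real q) ^ length vs"
    if "vs \<in> C" for vs
  proof -
    have sub: "cycle_edges vs \<subseteq> P"
      using that cycle_edges_two_subsets unfolding C_def P_def by blast
    then have "{f \<in> \<Omega>. cycle_edges vs \<subseteq> E f} = {f \<in> P \<rightarrow>\<^sub>E {..<q}. \<forall>e\<in>cycle_edges vs. f e \<in> {0}}"
      unfolding \<Omega>_def E_def by auto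
    then show ?thesis
      using card_PiE_constrained[OF finP sub, of "{..<q}" "{0}"] assms(1) that
      by (auto simp: M_def C_def card_cycle_edges)
  qed
  have ind_count: "real (card {f \<in> \<Omega>. independent_set (E f) S}) = M * (1 - 1 / real q) ^ (s choose 2)"
    if "S \<in> D" for S
  proof -
    let ?A = "{e. e \<subseteq> S \<and> card e = 2}"
    have sub: "?A \<subseteq> P" using that by (auto simp: P_def D_def)
    have finS: "finite S" using that finite_subset by (auto simp: D_def)
    have "independent_set (E f) S \<longleftrightarrow> (\<forall>e\<in>?A. f e \<noteq> 0)" for f
    proof
      assume ind: "independent_set (E f) S"
      show "\<forall>e\<in>?A. f e \<noteq> 0"
      proof
        fix e assume e: "e \<in> ?A"
        then obtain u v where uv: "e = {u, v}" "u \<noteq> v" by (auto simp: card_2_iff)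
        then have "e \<notin> E f" using ind e by (auto simp: independent_set_def)
        then show "f e \<noteq> 0" using sub e by (auto simp: E_def)
      qed
    next
      assume "\<forall>e\<in>?A. f e \<noteq> 0"
      then show "independent_set (E f) S" by (auto simp: independent_set_def E_def)
    qed
    then have "{f \<in> \<Omega>. independent_set (E f) S} = {f \<in> P \<rightarrow>\<^sub>E {..<q}. \<forall>e\<in>?A. f e \<in> {..<q} - {0}}"
      unfolding \<Omega>_def using sub by (auto simp: PiE_iff)
    then have "real (card {f \<in> \<Omega>. independent_set (E f) S}) = M * (real (q - 1) / real q) ^ card ?A"
      using card_PiE_constrained[OF finP sub, of "{..<q}" "{..<q} - {0}"] assms(1)
      by (auto simp: M_def)
    moreover have "card ?A = s choose 2"
      using n_subsets[OF finS] that by (simp add: D_def)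
    moreover have "real (q - 1) / real q = 1 - 1 / real q"
      using assms(1) by (simp add: field_simps of_nat_diff)
    ultimately show ?thesis by simp
  qed
  have "(\<Sum>f\<in>\<Omega>. cyc f) = (\<Sum>vs\<in>C. card {f \<in> \<Omega>. cycle_edges vs \<subseteq> E f})"
    unfolding cyc_def by (rule sum_multicount_gen[OF finO finC]) simp
  then have "(\<Sum>f\<in>\<Omega>. real (cyc f)) = M * (\<Sum>vs\<in>C. (1 / real q) ^ length vs)"
    by (simp add: cyc_count sum_distrib_left flip: of_nat_sum) (simp add: cyc_count)
  also have "\<dots> \<le> M * (\<Sum>l\<le>g. (real n / real q) ^ l)"
    using sum_over_short_cycles[of "1 / real q" n g] M by (simp add: C_def)
  finally have cyc_sum: "(\<Sum>f\<in>\<Omega>. real (cyc f)) \<le> M * (\<Sum>l\<le>g. (real n / real q) ^ l)" .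
  have "(\<Sum>f\<in>\<Omega>. ind f) = (\<Sum>S\<in>D. card {f \<in> \<Omega>. independent_set (E f) S})"
    unfolding ind_def by (rule sum_multicount_gen[OF finO finD]) simp
  then have "(\<Sum>f\<in>\<Omega>. real (ind f)) = real (card D) * (M * (1 - 1 / real q) ^ (s choose 2))"
    by (simp add: ind_count flip: of_nat_sum) (simp add: ind_count)
  also have "\<dots> \<le> 2 ^ n * (M * (1 - 1 / real q) ^ (s choose 2))"
  proof (rule mult_right_mono)
    have "card D \<le> card (Pow {..<n})"
      by (rule card_mono) (auto simp: D_def)
    then have "card D \<le> 2 ^ n" by (simp add: card_Pow)
    then show "real (card D) \<le> 2 ^ n"
      by (metis of_nat_le_iff of_nat_numeral of_nat_power)
    show "0 \<le> M * (1 - 1 / real q) ^ (s choose 2)"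
      using M assms(1) by simp
  qed
  finally have ind_sum: "(\<Sum>f\<in>\<Omega>. real (ind f)) \<le> 2 ^ n * (M * (1 - 1 / real q) ^ (s choose 2))" .
  have "M \<le> (\<Sum>f\<in>\<Omega>. 2 / real n * real (cyc f) + real (ind f))"
    using sum_mono[of \<Omega> "\<lambda>_. 1::real", OF one] card_O by simp
  also have "\<dots> = 2 / real n * (\<Sum>f\<in>\<Omega>. real (cyc f)) + (\<Sum>f\<in>\<Omega>. real (ind f))"
    by (simp add: sum.distrib sum_distrib_left)
  also have "\<dots> \<le> 2 / real n * (M * (\<Sum>l\<le>g. (real n / real q) ^ l))
      + 2 ^ n * (M * (1 - 1 / real q) ^ (s choose 2))"
    using cyc_sum ind_sum by (intro add_mono mult_left_mono) auto
  also have "\<dots> = M * (2 / real n * (\<Sum>l\<le>g. (real n / real q) ^ l)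
      + 2 ^ n * (1 - 1 / real q) ^ (s choose 2))"
    by (simp add: algebra_simps)
  also have "\<dots> < M * 1"
    using small M by (intro mult_strict_left_mono)
  finally show False by simp
qed

text \<open>
  With \<open>n = 2 * k * t * q\<close> and \<open>s = t * q\<close>, the factor \<open>2 ^ n\<close> counts the candidates for independent
  sets of size \<open>s\<close> (crudely, as all subsets), and the other factor is the probability that one of
  them is independent, which is at most \<open>exp (- t * (t * q - 1) / 2)\<close>. The exponent is quadratic in
  \<open>t\<close> while \<open>n\<close> is linear in \<open>t\<close>; the value \<open>4 * k + 3\<close> lets it exceed \<open>n\<close> by at least 1.
\<close>

lemma independence_estimate:
  fixes k q t :: nat
  assumes "q > 0" "t = 4 * k + 3"
  shows "2 ^ (2 * k * t * q) * (1 - 1 / real q) ^ ((t * q) choose 2) \<le> 1 / 2"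
proof -
  let ?n = "2 * k * t * q" and ?m = "(t * q) choose 2"
  have q: "real q \<ge> 1" using assms(1) by simp
  have "even (t * q * (t * q - 1))" by (cases "t * q") auto
  then have "real ?m = real (t * q) * (real (t * q) - 1) / 2"
    using assms by (simp add: choose_two real_of_nat_div of_nat_diff)
  then have m: "real ?m / real q = real t * (real t * real q - 1) / 2"
    using q by (simp add: field_simps)
  have "(2::real) \<le> exp 1" using exp_ge_add_one_self[of "1::real"] by simp
  then have "(2::real) ^ ?n \<le> exp 1 ^ ?n" by (intro power_mono) auto
  moreover have "(1 - 1 / real q) ^ ?m \<le> exp (- (1 / real q)) ^ ?m"
    using exp_ge_add_one_self[of "- (1 / real q)"] q by (intro power_mono) auto
  ultimately have "2 ^ ?n * (1 - 1 / real q) ^ ?m \<le> exp 1 ^ ?n * exp (- (1 / real q)) ^ ?m"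
    using q by (intro mult_mono) auto
  also have "\<dots> = exp (real ?n - real ?m / real q)"
    by (simp add: exp_of_nat_mult[symmetric] exp_add[symmetric] del: of_nat_mult)
  also have "\<dots> \<le> exp (-1)"
  proof -
    have "real ?m / real q - real ?n = real t / 2 * (3 * real q - 1)"
      using assms(2) m by (simp add: algebra_simps)
    moreover have "real t / 2 * (3 * real q - 1) \<ge> 3 / 2 * 2"
      using q assms(2) by (intro mult_mono) auto
    ultimately show ?thesis by simp
  qed
  also have "\<dots> \<le> 1 / 2"
    using \<open>2 \<le> exp 1\<close> by (simp add: exp_minus field_simps)
  finally show ?thesis .
qed

text \<open>
  The average degree \<open>d\<close> depends on \<open>k\<close> only and \<open>K\<close> bounds the expected number of short cycles, so
  a large \<open>q\<close> makes \<open>n = d * q\<close> exceed \<open>4 * K\<close>. Deletion of a vertex from each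
  short cycle then leaves more than \<open>n / 2\<close> vertices and creates no new independent sets. The conclusion
  bounds independent sets instead of the chromatic number, since this is what the passage from
  acyclic sets to independent sets uses.
\<close>

theorem large_girth_small_independence:
  fixes g k :: nat
  shows "\<exists>(V :: nat set) E. finite V
    \<and> (\<forall>vs. set vs \<subseteq> V \<and> undirected_cycle vs \<and> cycle_edges vs \<subseteq> E \<longrightarrow> g < length vs)
    \<and> (\<forall>I \<subseteq> V. independent_set E I \<longrightarrow> k * card I < card V)"
proof -
  \<comment> \<open>The successor keeps \<open>d\<close> and \<open>n\<close> positive in the case \<open>k = 0\<close>.\<close>
  define k' where "k' = Suc k"
  define t where "t = 4 * k' + 3"
  define d where "d = 2 * k' * t"
  define K where "K = (\<Sum>l\<le>g. d ^ l)"
  define q where "q = 4 * K + 1"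
  define n where "n = d * q"
  define s where "s = t * q"
  have d: "d > 0" by (simp add: d_def k'_def t_def)
  have q: "q > 0" by (simp add: q_def)
  have n: "n > 0" using d q by (simp add: n_def)
  have "q \<le> n" using d by (simp add: n_def)
  then have "real (4 * K) < real n" unfolding q_def by linarith
  then have "2 / real n * real K < 1 / 2" using n by (simp add: field_simps)
  moreover have degree: "(\<Sum>l\<le>g. (real n / real q) ^ l) = real K"
    using q by (simp add: n_def K_def)
  moreover have "2 ^ n * (1 - 1 / real q) ^ (s choose 2) \<le> 1 / 2"
    using independence_estimate[OF q t_def] unfolding n_def d_def s_def .
  ultimately have "2 / real n * (\<Sum>l\<le>g. (real n / real q) ^ l)
      + 2 ^ n * (1 - 1 / real q) ^ (s choose 2) < 1"
    unfolding degree by linarith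
  from first_moment[OF q n this] obtain E where
    cyc: "2 * card {vs. set vs \<subseteq> {..<n} \<and> undirected_cycle vs \<and> length vs \<le> g \<and> cycle_edges vs \<subseteq> E} < n"
    and ind: "\<And>S. S \<subseteq> {..<n} \<Longrightarrow> card S = s \<Longrightarrow> \<not> independent_set E S"
    by blast
  define C where "C = {vs. set vs \<subseteq> {..<n} \<and> undirected_cycle vs \<and> length vs \<le> g \<and> cycle_edges vs \<subseteq> E}"
  define V where "V = {..<n} - hd ` C"
  have "C \<subseteq> {vs. set vs \<subseteq> {..<n} \<and> length vs \<le> g}" unfolding C_def by auto
  then have finC: "finite C" using finite_lists_length_le finite_subset by blast
  have "n \<le> card V + card (hd ` C)"
    using diff_card_le_card_Diff[of "hd ` C" "{..<n}"] finC by (simp add: V_def)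
  moreover have "card (hd ` C) \<le> card C" using finC by (rule card_image_le)
  ultimately have "n < 2 * card V" using cyc by (simp add: C_def)
  then have V: "k' * s < card V" by (simp add: n_def d_def s_def mult.assoc)
  have "g < length vs" if "set vs \<subseteq> V" "undirected_cycle vs" "cycle_edges vs \<subseteq> E" for vs
  proof (rule ccontr)
    assume "\<not> g < length vs"
    with that have "vs \<in> C" by (auto simp: C_def V_def)
    moreover have "hd vs \<in> set vs"
      using that(2) by (intro hd_in_set) (auto simp: undirected_cycle_def)
    ultimately show False using that(1) by (auto simp: V_def)
  qed
  moreover have "k * card I < card V" if "I \<subseteq> V" "independent_set E I" for I
  proof -
    have "card I < s"
    proof (rule ccontr)
      assume "\<not> card I < s"
      then obtain S where "S \<subseteq> I" "card S = s"
        by (meson not_le_imp_less obtain_subset_with_card_n linorder_not_less)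
      then show False
        using ind[of S] that by (auto simp: V_def independent_set_def)
    qed
    then have "k * card I \<le> k' * s" by (intro mult_le_mono) (auto simp: k'_def)
    then show ?thesis using V by simp
  qed
  ultimately show ?thesis by (intro exI[of _ V] exI[of _ E]) (auto simp: V_def)
qed

section \<open>The tournament with a prescribed backedge graph\<close>

lemma cycle_edges_triangle: "cycle_edges [a, b, c] = {{a, b}, {b, c}, {c, a}}"
proof -
  have "{..<length [a, b, c]} = {0, 1, 2}" by auto
  then show ?thesis by (auto simp: cycle_edges_def)
qed

definition triangle_free :: "'a set \<Rightarrow> 'a set set \<Rightarrow> bool" where
  "triangle_free V E \<longleftrightarrow> (\<forall>a\<in>V. \<forall>b\<in>V. \<forall>c\<in>V.
    distinct [a, b, c] \<longrightarrow> {a, b} \<in> E \<longrightarrow> {b, c} \<in> E \<longrightarrow> {c, a} \<notin> E)"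

lemma triangle_freeD:
  assumes "triangle_free V E" "a \<in> V" "b \<in> V" "c \<in> V" "distinct [a, b, c]"
    and "{a, b} \<in> E" "{b, c} \<in> E"
  shows "{c, a} \<notin> E"
  using assms unfolding triangle_free_def by blast

definition tournament_of :: "'a::linorder set \<Rightarrow> 'a set set \<Rightarrow> 'a pair_pre_digraph" where
  "tournament_of V E =
    \<lparr> pverts = V, parcs = {(u, v). u \<in> V \<and> v \<in> V \<and> u \<noteq> v \<and> (u < v \<longleftrightarrow> {u, v} \<notin> E)} \<rparr>"

lemma pverts_tournament_of [simp]: "pverts (tournament_of V E) = V"
  by (simp add: tournament_of_def)

lemma parcs_tournament_of:
  "(u, v) \<in> parcs (tournament_of V E) \<longleftrightarrow> u \<in> V \<and> v \<in> V \<and> u \<noteq> v \<and> (u < v \<longleftrightarrow> {u, v} \<notin> E)"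
  by (simp add: tournament_of_def)

lemma tournament_tournament_of:
  assumes "finite V"
  shows "tournament (tournament_of V E)"
proof
  have "parcs (tournament_of V E) \<subseteq> V \<times> V"
    by (auto simp: parcs_tournament_of)
  then show "finite (parcs (tournament_of V E))"
    using assms by (meson finite_SigmaI finite_subset)
  show "(u, v) \<in> parcs (tournament_of V E) \<or> (v, u) \<in> parcs (tournament_of V E)"
    if "u \<in> pverts (tournament_of V E)" "v \<in> pverts (tournament_of V E)" "u \<noteq> v" for u v
    using that by (auto simp: parcs_tournament_of insert_commute)
qed (use assms in \<open>auto simp: parcs_tournament_of insert_commute\<close>)

lemma directed_clique_number_tournament_of:
  assumes fin: "finite V"
    and free: "triangle_free V E"
  shows "directed_clique_number (tournament_of V E) \<le> 2"
proof -
  let ?T = "tournament_of V E"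
  let ?r = "{(u, v). u \<in> V \<and> v \<in> V \<and> u \<le> v}"
  let ?B = "backedge_graph ?T ?r"
  have lin: "linear_order_on V ?r"
    by (auto simp: linear_order_on_def partial_order_on_def preorder_on_def refl_on_def
        trans_def antisym_def total_on_def)
  have edge: "{u, v} \<in> E" if "(u, v) \<in> parcs ?B" for u v
    using that by (auto simp: backedge_graph_def Let_def parcs_tournament_of insert_commute)
  have card: "card X \<le> 2" if X: "clique ?B X" for X
  proof (rule ccontr)
    assume "\<not> card X \<le> 2"
    then have "3 \<le> card X" by simp
    then obtain Y where "Y \<subseteq> X" "card Y = 3"
      by (meson obtain_subset_with_card_n)
    then obtain a b c where abc: "{a, b, c} \<subseteq> X" "a \<noteq> b" "b \<noteq> c" "a \<noteq> c"
      by (auto simp: card_3_iff)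
    moreover have "X \<subseteq> V"
      using X by (simp add: clique_def backedge_graph_def)
    ultimately have "a \<in> V" "b \<in> V" "c \<in> V" by auto
    moreover have "{a, b} \<in> E" "{b, c} \<in> E" "{c, a} \<in> E"
      using X abc by (intro edge; simp add: clique_def)+
    ultimately show False
      using triangle_freeD[OF free, of a b c] abc(2-) by simp
  qed
  have "finite {X. clique ?B X}"
    using fin by (rule finite_subset[rotated, OF finite_Pow_iff[THEN iffD2]])
      (auto simp: clique_def backedge_graph_def)
  moreover have "clique ?B {}" by (simp add: clique_def)
  ultimately have "clique_number ?B \<le> 2"
    unfolding clique_number_def using card by (subst Max_le_iff) auto
  moreover have "directed_clique_number ?T \<le> clique_number ?B"
    unfolding directed_clique_number_def using lin by (intro Least_le) auto
  ultimately show ?thesis by simp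
qed

section \<open>Acyclic sets and the dichromatic number\<close>

lemma acyclic_imp_no_directed_triangle:
  assumes "acyclic_digraph (with_proj D \<restriction> X)" "{a, b, c} \<subseteq> X" "distinct [a, b, c]"
    and "(a, b) \<in> parcs D" "(b, c) \<in> parcs D"
  shows "(c, a) \<notin> parcs D"
proof
  assume "(c, a) \<in> parcs D"
  then have "pre_digraph.cycle (with_proj D \<restriction> X) [(a, b), (b, c), (c, a)]"
    using assms(2-)
    by (auto simp: pre_digraph.cycle_def pre_digraph.awalk_def pre_digraph.cas.simps
        pre_digraph.awalk_verts.simps intro!: exI[of _ a])
  then show False using assms(1) by (auto simp: acyclic_digraph_def)
qed

text \<open>
  The vertices of \<open>X\<close> are split by whether they have a smaller neighbour in \<open>X\<close>. Two adjacent vertices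
  \<open>u < v\<close> that both have one would give \<open>w < u < v\<close> with edges \<open>wu\<close> and \<open>uv\<close>, so arcs \<open>v \<rightarrow> u \<rightarrow> w\<close>;
  as \<open>E\<close> has no triangle, \<open>wv\<close> is not an edge, and \<open>w \<rightarrow> v\<close> closes a directed triangle in \<open>X\<close>.
\<close>

lemma acyclic_splits_into_independent_sets:
  assumes acyc: "acyclic_digraph (with_proj (tournament_of V E) \<restriction> X)" and X: "X \<subseteq> V"
    and free: "triangle_free V E"
  shows "\<exists>A B. X = A \<union> B \<and> independent_set E A \<and> independent_set E B"
proof (intro exI conjI)
  define B where "B = {v \<in> X. \<exists>u\<in>X. u < v \<and> {u, v} \<in> E}"
  show "X = (X - B) \<union> B" by (auto simp: B_def)
  have "{u, v} \<notin> E" if "u \<in> X - B" "v \<in> X - B" "u \<noteq> v" for u v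
    using that by (cases u v rule: linorder_cases) (auto simp: B_def insert_commute)
  then show "independent_set E (X - B)" by (simp add: independent_set_def)
  have asc: "{u, v} \<notin> E" if u: "u \<in> B" and v: "v \<in> B" and "u < v" for u v
  proof
    assume uv: "{u, v} \<in> E"
    obtain w where w: "w \<in> X" "w < u" "{w, u} \<in> E" using u by (auto simp: B_def)
    have d: "distinct [w, u, v]" "distinct [w, v, u]" using w \<open>u < v\<close> by auto
    have V: "w \<in> V" "u \<in> V" "v \<in> V" using u v w X by (auto simp: B_def)
    have "{v, w} \<notin> E" using triangle_freeD[OF free V d(1) w(3) uv] .
    then have "(w, v) \<in> parcs (tournament_of V E)" 
      using V d w \<open>u < v\<close> by (auto simp: parcs_tournament_of insert_commute)
    moreover have "(v, u) \<in> parcs (tournament_of V E)" "(u, w) \<in> parcs (tournament_of V E)"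
      using V w uv \<open>u < v\<close> by (auto simp: parcs_tournament_of insert_commute)
    moreover have "{w, v, u} \<subseteq> X" using u v w by (auto simp: B_def)
    ultimately show False
      using acyclic_imp_no_directed_triangle[OF acyc] d by blast
  qed
  have "{u, v} \<notin> E" if "u \<in> B" "v \<in> B" "u \<noteq> v" for u v
    using that asc[of u v] asc[of v u] by (cases u v rule: linorder_cases) (auto simp: insert_commute)
  then show "independent_set E B" by (simp add: independent_set_def)
qed

text \<open>
  The minimum that defines the dichromatic number is attained, because the partition into singletons
  is always admissible.
\<close>

lemma acyclic_colouring_exists:
  assumes "pair_digraph D"
  shows "\<exists>P. partition_on (pverts D) P \<and> card P = dichromatic_number D
    \<and> (\<forall>X\<in>P. acyclic_digraph (with_proj D \<restriction> X))"
proof -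
  interpret pair_digraph D by (fact assms)
  have "acyclic_digraph (with_proj D \<restriction> {x})" for x
  proof -
    have "arcs (with_proj D \<restriction> {x}) = {}" using pair_no_loops by force
    then show ?thesis
      unfolding acyclic_digraph_def pre_digraph.cycle_def pre_digraph.awalk_def
      by (metis set_empty subset_empty)
  qed
  then have "\<exists>k P. partition_on (pverts D) P \<and> card P = k
      \<and> (\<forall>X\<in>P. acyclic_digraph (with_proj D \<restriction> X))"
    using partition_on_singletons[of "pverts D"] by fastforce
  then show ?thesis
    unfolding dichromatic_number_def by (rule LeastI_ex)
qed

lemma card_le_dichromatic_number:
  assumes fin: "finite V"
    and free: "triangle_free V E"
    and ind: "\<And>I. \<lbrakk>I \<subseteq> V; independent_set E I\<rbrakk> \<Longrightarrow> card I \<le> m"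
  shows "card V \<le> 2 * m * dichromatic_number (tournament_of V E)"
proof -
  let ?T = "tournament_of V E"
  interpret tournament ?T using fin by (rule tournament_tournament_of)
  obtain P where P: "partition_on V P" "card P = dichromatic_number ?T"
      "\<And>X. X \<in> P \<Longrightarrow> acyclic_digraph (with_proj ?T \<restriction> X)"
    using acyclic_colouring_exists[of ?T] pair_digraph_axioms by auto
  have V: "V = \<Union>P" using P(1) by (rule partition_onD1)
  have "card X \<le> 2 * m" if XP: "X \<in> P" for X
  proof -
    have "X \<subseteq> V" using V XP by blast
    then obtain A B where AB: "X = A \<union> B" "independent_set E A" "independent_set E B"
      using acyclic_splits_into_independent_sets[OF P(3)[OF XP] \<open>X \<subseteq> V\<close> free] by blast
    then have "card A \<le> m" "card B \<le> m" using ind \<open>X \<subseteq> V\<close> by auto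
    then show ?thesis using card_Un_le[of A B] AB(1) by simp
  qed
  then have "(\<Sum>X\<in>P. card X) \<le> card P * (2 * m)"
    using sum_bounded_above[of P card "2 * m"] by simp
  moreover have "card V \<le> (\<Sum>X\<in>P. card X)"
    using card_Union_le_sum_card[of P] V by simp
  ultimately show ?thesis using P(2) by (simp add: mult.commute)
qed

section \<open>Copies in the tournament and forest orderings\<close>

lemma pcas_nth:
  assumes "pcas u p v" "p \<noteq> []"
  shows "fst (p ! 0) = u \<and> snd (last p) = v
    \<and> (\<forall>i. Suc i < length p \<longrightarrow> fst (p ! Suc i) = snd (p ! i))"
  using assms
proof (induction p arbitrary: u)
  case Nil
  then show ?case by simp
next
  case (Cons e es)
  show ?case
  proof (cases "es = []")
    case True
    then show ?thesis using Cons.prems by auto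
  next
    case False
    then show ?thesis
      using Cons.prems Cons.IH[of "snd e"] by (auto simp: nth_Cons split: nat.split)
  qed
qed

lemma tl_pawalk_verts: "pcas u p v \<Longrightarrow> tl (pawalk_verts u p) = map snd p"
proof (induction p arbitrary: u)
  case (Cons e es)
  then show ?case by (cases es) auto
qed simp

text \<open>
  The heads of the arcs of a cycle, unlike all the vertices of the closed walk, are listed without
  repetition.
\<close>

lemma cycle_with_proj_imp_undirected_cycle:
  assumes "pre_digraph.cycle (with_proj G) p" "3 \<le> length p"
  shows "undirected_cycle (map snd p)"
    and "cycle_edges (map snd p) \<subseteq> {{a, b} | a b. (a, b) \<in> parcs G}"
proof -
  obtain u where p: "set p \<subseteq> parcs G" "pcas u p u" "distinct (tl (pawalk_verts u p))" "p \<noteq> []"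
    using assms(1) by (auto simp: pre_digraph.cycle_def pre_digraph.awalk_def
        cas_with_proj_eq awalk_verts_with_proj_eq)
  show "undirected_cycle (map snd p)"
    using p assms(2) by (simp add: undirected_cycle_def tl_pawalk_verts)
  show "cycle_edges (map snd p) \<subseteq> {{a, b} | a b. (a, b) \<in> parcs G}"
  proof
    fix e assume "e \<in> cycle_edges (map snd p)"
    then obtain i where i: "i < length p" "e = {map snd p ! i, map snd p ! (Suc i mod length p)}"
      by (auto simp: cycle_edges_def)
    let ?j = "Suc i mod length p"
    have j: "?j < length p" using i by (intro mod_less_divisor) auto
    then have e: "e = {snd (p ! i), snd (p ! ?j)}" using i by simp
    have "fst (p ! ?j) = snd (p ! i)"
    proof (cases "Suc i < length p")
      case True
      then show ?thesis using pcas_nth[OF p(2,4)] by simp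
    next
      case False
      then have "Suc i = length p" using i by simp
      then have "last p = p ! i" "?j = 0"
        by (metis p(4) last_conv_nth diff_Suc_1, simp)
      then show ?thesis using pcas_nth[OF p(2,4)] by simp
    qed
    then have "(snd (p ! i), snd (p ! ?j)) = p ! ?j" by (metis prod.collapse)
    moreover have "p ! ?j \<in> parcs G" using j p(1) nth_mem by blast
    ultimately show "e \<in> {{a, b} | a b. (a, b) \<in> parcs G}"
      unfolding e by (metis (mono_tags, lifting) mem_Collect_eq)
  qed
qed

lemma cycle_edges_map: "cycle_edges (map f vs) = (`) f ` cycle_edges vs"
proof -
  have "map f vs ! (Suc i mod length vs) = f (vs ! (Suc i mod length vs))"
    if "i < length vs" for i
    using that by (intro nth_map mod_less_divisor) auto
  then show ?thesis
    by (auto simp: cycle_edges_def image_image intro!: image_cong)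
qed

text \<open>
  The isomorphism pulls the order of \<open>V\<close> back to \<open>H\<close> and maps backedges of \<open>H\<close> to edges of \<open>E\<close>. A cycle
  in the backedge graph of \<open>H\<close> would thus yield a cycle in \<open>E\<close> on at most \<open>card (pverts H)\<close> vertices.
\<close>

lemma forest_order_of_contains_copy:
  fixes H :: "'a pair_pre_digraph"
  assumes H: "pair_digraph H"
    and copy: "contains_copy (tournament_of V E) H"
    and girth: "\<And>vs. \<lbrakk>set vs \<subseteq> V; undirected_cycle vs; cycle_edges vs \<subseteq> E\<rbrakk> \<Longrightarrow>
      card (pverts H) < length vs"
  shows "\<exists>r. linear_order_on (pverts H) r \<and> undirected_forest (backedge_graph H r)"
proof -
  interpret H: pair_digraph H by (fact H)
  let ?T = "tournament_of V E"
  obtain X h where X: "X \<subseteq> V" and iso: "pre_digraph.digraph_isomorphism (with_proj H) h"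
    and T: "with_proj ?T \<restriction> X = app_iso h (with_proj H)"
    using copy by (auto simp: contains_copy_def digraph_iso_def)
  define f where "f = iso_verts h"
  have inj: "inj_on f (pverts H)"
    using iso by (simp add: pre_digraph.digraph_isomorphism_def f_def)
  have fV: "f ` pverts H \<subseteq> V"
    using arg_cong[OF T, of verts] X by (simp add: f_def)
  have arc: "(f u, f v) \<in> parcs ?T" if "(u, v) \<in> parcs H" for u v
  proof -
    have "iso_tail h = fst" "iso_head h = snd"
      using arg_cong[OF T, of tail] arg_cong[OF T, of head] by simp_all
    then have "iso_arcs h (u, v) = (f u, f v)"
      using iso that by (auto simp: pre_digraph.digraph_isomorphism_def f_def prod_eq_iff)
    moreover have "iso_arcs h (u, v) \<in> arcs (with_proj ?T \<restriction> X)"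
      unfolding T using that by simp
    ultimately show ?thesis by simp
  qed
  define r where "r = {(u, v). u \<in> pverts H \<and> v \<in> pverts H \<and> f u \<le> f v}"
  have "linear_order_on (pverts H) r"
    using inj by (auto simp: r_def linear_order_on_def partial_order_on_def preorder_on_def
        refl_on_def trans_def antisym_def total_on_def inj_on_def)
  moreover have "undirected_forest (backedge_graph H r)"
    unfolding undirected_forest_def
  proof (intro notI, elim exE conjE)
    fix p assume p: "pre_digraph.cycle (with_proj (backedge_graph H r)) p" "3 \<le> length p"
    note C = cycle_with_proj_imp_undirected_cycle[OF p]
    let ?vs = "map snd p"
    have "set p \<subseteq> parcs (backedge_graph H r)"
      using p(1) by (auto simp: pre_digraph.cycle_def pre_digraph.awalk_def)
    then have vs: "set ?vs \<subseteq> pverts H"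
      by (auto simp: backedge_graph_def Let_def r_def dest!: subsetD)
    have "f ` e \<in> E" if e: "e \<in> cycle_edges ?vs" for e
    proof -
      obtain a b where "e = {a, b}" and "(a, b) \<in> parcs (backedge_graph H r)"
        using e C(2) by blast
      then obtain u v where "e = {u, v}" and "(u, v) \<in> r" "(v, u) \<in> parcs H" "u \<noteq> v"
        by (auto simp: backedge_graph_def Let_def)
      then show ?thesis
        using arc[of v u] by (auto simp: r_def parcs_tournament_of insert_commute)
    qed
    then have "cycle_edges (map f ?vs) \<subseteq> E"
      unfolding cycle_edges_map by blast
    moreover have "undirected_cycle (map f ?vs)"
      using C(1) inj_on_subset[OF inj vs] by (simp add: undirected_cycle_def distinct_map comp_inj_on)
    moreover have "set (map f ?vs) \<subseteq> V"
      using vs fV by auto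
    ultimately have "card (pverts H) < length (map f ?vs)"
      by (intro girth)
    moreover have "length ?vs \<le> card (pverts H)"
      using C(1) vs card_mono[OF H.pair_finite_verts] distinct_card[of ?vs]
      by (metis undirected_cycle_def)
    ultimately show False by simp
  qed
  ultimately show ?thesis by blast
qed

section \<open>Binding tournaments have forest orderings\<close>

theorem theorem4p5:
  fixes H :: "'a pair_pre_digraph"
  assumes "tournament H"
    and "dichi_binding H"
  shows "\<exists>r. linear_order_on (pverts H) r \<and> undirected_forest (backedge_graph H r)"
proof -
  interpret H: tournament H by (fact assms(1))
  obtain f :: "nat \<Rightarrow> nat" where f: "mono f"
    and bound: "\<And>T :: nat pair_pre_digraph. tournament T \<Longrightarrow> \<not> contains_copy T H \<Longrightarrow>
      dichromatic_number T \<le> f (directed_clique_number T)"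
    using assms(2) by (auto simp: dichi_binding_def dichi_bounded_def)
  obtain V :: "nat set" and E where fin: "finite V"
    and girth: "\<And>vs. \<lbrakk>set vs \<subseteq> V; undirected_cycle vs; cycle_edges vs \<subseteq> E\<rbrakk> \<Longrightarrow>
      max 3 (card (pverts H)) < length vs"
    and ind: "\<And>I. \<lbrakk>I \<subseteq> V; independent_set E I\<rbrakk> \<Longrightarrow> 2 * f 2 * card I < card V"
    using large_girth_small_independence[of "max 3 (card (pverts H))" "2 * f 2"] by blast
  let ?T = "tournament_of V E"
  have free: "triangle_free V E"
    unfolding triangle_free_def
  proof (intro ballI impI notI)
    fix a b c assume "a \<in> V" "b \<in> V" "c \<in> V" "distinct [a, b, c]"
      and "{a, b} \<in> E" "{b, c} \<in> E" "{c, a} \<in> E"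
    then show False
      using girth[of "[a, b, c]"] by (simp add: undirected_cycle_def cycle_edges_triangle)
  qed
  have "f 2 < dichromatic_number ?T"
  proof (rule ccontr)
    assume small: "\<not> f 2 < dichromatic_number ?T"
    \<comment> \<open>Two independent sets per colour class cannot cover \<open>V\<close>, even if both had maximum size.\<close>
    have "finite (card ` {I. I \<subseteq> V \<and> independent_set E I})" using fin by simp
    moreover have "independent_set E {}" by (simp add: independent_set_def)
    ultimately obtain I where I: "I \<subseteq> V" "independent_set E I"
      and max: "\<And>J. \<lbrakk>J \<subseteq> V; independent_set E J\<rbrakk> \<Longrightarrow> card J \<le> card I"
      using Max_in[of "card ` {I. I \<subseteq> V \<and> independent_set E I}"]
        Max_ge[of "card ` {I. I \<subseteq> V \<and> independent_set E I}"] by fastforce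
    have "card V \<le> 2 * card I * dichromatic_number ?T"
      using max by (intro card_le_dichromatic_number[OF fin free]) auto
    also have "\<dots> \<le> 2 * card I * f 2"
      using small by (intro mult_left_mono) auto
    finally show False
      using ind[OF I] by (simp add: mult.assoc mult.left_commute mult.commute)
  qed
  moreover have "f (directed_clique_number ?T) \<le> f 2"
    using directed_clique_number_tournament_of[OF fin free] by (rule monoD[OF f])
  ultimately have "contains_copy ?T H"
    using bound[OF tournament_tournament_of[OF fin]] by fastforce
  then show ?thesis
    using forest_order_of_contains_copy[OF H.pair_digraph_axioms] girth by (metis max_less_iff_conj)
qed

end
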